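(* Let $m$ be a positive integer with $m\not\equiv 1\pmod 3$. Then the function $f:\mathbb{F}_{2^{3m}}\to\mathbb{F}_{2^{3m}}$, $$f(x)=x^{2^{2m}+1}+x^{2^{2m}+2^m},$$ is pseudo-planar on $\mathbb{F}_{2^{3m}}$.
   Context: A function $f:\mathbb{F}_{2^n}\to\mathbb{F}_{2^n}$ is called pseudo-planar if for every $\epsilon\in\mathbb{F}_{2^n}^*$ the map $x\mapsto f(x+\epsilon)+f(x)+\epsilon x$ is a permutation of $\mathbb{F}_{2^n}$. *)

theory Defs
  imports "HOL-Library.Cardinality" "HOL-Number_Theory.Cong"
begin

text \<open>
  A finite field is a type of class \<open>field\<close> and \<open>finite\<close>; it is the field with \<open>2 ^ n\<close> elements
  iff its cardinality is \<open>2 ^ n\<close>, and it then has characteristic two. The notion below is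
  intended for such fields only, so that requirement is stated where the notion is used.
\<close>

definition pseudo_planar :: "('a::{field, finite} \<Rightarrow> 'a) \<Rightarrow> bool" where
  "pseudo_planar f \<longleftrightarrow> (\<forall>\<epsilon>. \<epsilon> \<noteq> 0 \<longrightarrow> bij (\<lambda>x. f (x + \<epsilon>) + f x + \<epsilon> * x))"

end

(*
  Write q = 2^m, b = a^q, c = a^(q^2). Up to a constant, f (x + a) + f x + a x is the additive map
  x |-> (a + c) x + c x^q + (a + b) x^(q^2), so it suffices that its kernel is trivial. An element
  of the kernel, together with its conjugates x^q and x^(q^2), solves a 3 x 3 linear system with
  determinant a^3 + b^3 + c^3 + a^2 b + b^2 c + c^2 a + a b c. Over the subfield with 8 elements
  this cubic form is the product of the three conjugates of a + t b + t^3 c, where t^3 = t^2 + 1.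
  If such a factor vanished, its conjugates would give another 3 x 3 system, now for (a, b, c), with
  coefficients in the field with 8 elements. As t^7 = 1, these depend only on m mod 3, and the
  determinant is nonzero unless m = 1 (mod 3); hence a = 0.
*)
theory Submission
  imports Defs "HOL-Number_Theory.Residues" "HOL-Computational_Algebra.Polynomial"
begin

section \<open>Finite fields: characteristic, Fermat's theorem, roots of unity\<close>

lemma CHAR_eq_2_of_card:
  assumes "CARD('a::{field, finite}) = 2 ^ k"
  shows "CHAR('a) = 2"
proof -
  have "prime CHAR('a)"
    by (rule prime_CHAR_semidom) (simp add: finite_imp_CHAR_pos)
  moreover have "CHAR('a) dvd 2 ^ k"
    using CHAR_dvd_CARD[where 'a = 'a] assms by simp
  ultimately show ?thesis
    by (metis prime_dvd_power primes_dvd_imp_eq two_is_prime_nat)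
qed

lemma power_card_minus_1_eq_1:
  fixes x :: "'a::{field, finite}"
  assumes "x \<noteq> 0"
  shows "x ^ (CARD('a) - 1) = 1"
proof -
  have "(\<Prod>y\<in>UNIV-{0}. y) = (\<Prod>y\<in>UNIV-{0}. x * y)"
    by (rule prod.reindex_bij_witness[of _ "\<lambda>y. x * y" "\<lambda>y. y / x"]) (use assms in auto)
  also have "\<dots> = x ^ (CARD('a) - 1) * (\<Prod>y\<in>UNIV-{0::'a}. y)"
    by (simp add: prod.distrib card_Diff_singleton)
  finally show ?thesis
    by simp
qed

lemma power_card_eq_self: "x ^ CARD('a) = x" for x :: "'a::{field, finite}"
proof (cases "x = 0")
  case False
  have "x ^ CARD('a) = x * x ^ (CARD('a) - 1)"
    by (simp flip: power_Suc)
  then show ?thesis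
    using power_card_minus_1_eq_1[OF False] by simp
qed simp

text \<open>With \<open>k = (CARD('a) - 1) / d\<close>, the polynomial \<open>X ^ k - 1\<close> has
  too few roots to kill every nonzero element; the \<open>k\<close>-th power of one that it misses
  is the desired \<open>w\<close>.\<close>

lemma exists_nontrivial_root_of_unity:
  assumes "d dvd CARD('a::{field, finite}) - 1" and "d > 1"
  shows "\<exists>w::'a. w ^ d = 1 \<and> w \<noteq> 1"
proof -
  define n where "n = CARD('a) - 1"
  obtain k where k: "n = d * k"
    using assms(1) unfolding n_def by (auto elim: dvdE)
  have "card {0, 1 :: 'a} \<le> CARD('a)"
    by (rule card_mono) auto
  then have "n > 0"
    by (simp add: n_def)
  then have "k > 0"
    using k by (cases k) auto
  define p :: "'a poly" where "p = monom 1 k - 1"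
  have "p \<noteq> 0"
    using \<open>k > 0\<close> by (auto simp: p_def monom_eq_1_iff)
  have "degree p \<le> k"
    unfolding p_def by (rule degree_diff_le) (auto simp: degree_monom_le)
  then have "card {x. poly p x = 0} \<le> k"
    using card_poly_roots_bound[OF \<open>p \<noteq> 0\<close>] by simp
  also have "k < n"
    using k \<open>k > 0\<close> assms(2) by simp
  also have "n = card (UNIV - {0 :: 'a})"
    by (simp add: n_def card_Diff_singleton)
  finally have "\<not> UNIV - {0} \<subseteq> {x. poly p x = 0}"
    using card_mono[of "{x. poly p x = 0}" "UNIV - {0}"] by fastforce
  then obtain y where "y \<noteq> 0" "poly p y \<noteq> 0"
    by blast
  then have y: "y \<noteq> 0" "y ^ k \<noteq> 1"
    by (simp_all add: p_def poly_monom)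
  have "(y ^ k) ^ d = 1"
    using power_card_minus_1_eq_1[OF y(1)] k by (simp add: n_def mult.commute flip: power_mult)
  with y(2) show ?thesis
    by blast
qed

section \<open>Characteristic two and the cubic \<open>X ^ 3 = X ^ 2 + 1\<close>\<close>

lemma char_2_add_self:
  fixes x y :: "'a::comm_ring_1"
  assumes "(2::'a) = 0"
  shows "x + x = 0" "x + (x + y) = y"
proof -
  show "x + x = 0"
    using assms by (simp flip: mult_2)
  then show "x + (x + y) = y"
    by (simp flip: add.assoc)
qed

lemma char_2_diff:
  fixes x y :: "'a::comm_ring_1"
  assumes "(2::'a) = 0"
  shows "x - y = x + y"
  using char_2_add_self(1)[OF assms, of y] by (simp add: algebra_simps)

lemma power_mod_exponent:
  fixes t :: "'a::monoid_mult"
  assumes "t ^ d = 1"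
  shows "t ^ n = t ^ (n mod d)"
  by (metis assms mult.left_neutral mult_div_mod_eq power_add power_mult power_one)

lemma seven_dvd_8_power_minus_1: "(7::nat) dvd 2 ^ (3 * m) - 1"
proof -
  have "[(8::nat) ^ m = 1 ^ m] (mod 7)"
    by (rule cong_pow) (simp add: cong_def)
  then have "[(2::nat) ^ (3 * m) = 1] (mod 7)"
    by (simp add: power_mult)
  then show ?thesis
    by (simp add: cong_altdef_nat cong_to_1_nat)
qed

text \<open>Seven divides the order of the multiplicative group, so there is a nontrivial seventh
  root of unity; in characteristic two \<open>X ^ 7 - 1\<close> is \<open>X - 1\<close> times two
  reciprocal cubics, one of them the wanted one.\<close>

lemma exists_cubic_root_char_2:
  assumes card: "CARD('a::{field, finite}) = 2 ^ (3 * m)" and "m > 0"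
  shows "\<exists>t::'a. t ^ 3 = t ^ 2 + 1"
proof -
  have two: "(2::'a) = 0"
    using CHAR_eq_2_of_card[OF card] of_nat_CHAR[where 'a = 'a] by simp
  obtain w :: 'a where w: "w ^ 7 = 1" "w \<noteq> 1"
    using exists_nontrivial_root_of_unity[where 'a = 'a and d = 7]
      seven_dvd_8_power_minus_1[of m] card by auto
  have "(w - 1) * ((w ^ 3 - w ^ 2 - 1) * (w ^ 3 - w - 1)) = 0"
  proof -
    have "(w - 1) * ((w ^ 3 - w ^ 2 - 1) * (w ^ 3 - w - 1)) = w ^ 7 - 1"
      unfolding char_2_diff[OF two]
      by (simp add: eval_nat_numeral algebra_simps char_2_add_self[OF two])
    then show ?thesis
      using w(1) by simp
  qed
  then have "w ^ 3 - w ^ 2 - 1 = 0 \<or> w ^ 3 - w - 1 = 0"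
    using w(2) by simp
  then consider "w ^ 3 = w ^ 2 + 1" | "w ^ 3 = w + 1"
    by (auto simp: diff_diff_eq)
  then show ?thesis
  proof cases
    \<comment> \<open>The two cubics are reciprocal, and \<open>w ^ 6\<close> is the inverse of \<open>w\<close>.\<close>
    case 2
    have w4: "w ^ 4 = w ^ 2 + w"
      using arg_cong[OF 2, of "\<lambda>y. w * y"] by (simp add: eval_nat_numeral algebra_simps)
    have "w ^ 5 = w ^ 3 + w ^ 2"
      using arg_cong[OF w4, of "\<lambda>y. w * y"] by (simp add: eval_nat_numeral algebra_simps)
    then have "w ^ 4 = w ^ 5 + 1"
      unfolding w4 2 by (simp add: ac_simps char_2_add_self[OF two])
    moreover have "(w ^ 6) ^ 3 = w ^ 4" "(w ^ 6) ^ 2 = w ^ 5"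
      using power_mod_exponent[OF w(1), of 18] power_mod_exponent[OF w(1), of 12]
      by (simp_all flip: power_mult)
    ultimately have "(w ^ 6) ^ 3 = (w ^ 6) ^ 2 + 1"
      by simp
    then show ?thesis ..
  qed auto
qed

text \<open>The factor of \<open>x\<close> is the determinant of the system: weighting the equations
  with the cofactors of the first column eliminates \<open>y\<close> and \<open>z\<close>.\<close>

lemma cramer3:
  fixes x y z :: "'a::comm_ring_1"
  assumes "a1 * x + b1 * y + c1 * z = 0" "a2 * x + b2 * y + c2 * z = 0"
    "a3 * x + b3 * y + c3 * z = 0"
  shows "(a1 * (b2 * c3 - c2 * b3) + b1 * (c2 * a3 - a2 * c3) + c1 * (a2 * b3 - b2 * a3)) * x = 0"
proof -
  have "(a1 * (b2 * c3 - c2 * b3) + b1 * (c2 * a3 - a2 * c3) + c1 * (a2 * b3 - b2 * a3)) * x =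
      (b2 * c3 - c2 * b3) * (a1 * x + b1 * y + c1 * z) -
      (b1 * c3 - c1 * b3) * (a2 * x + b2 * y + c2 * z) +
      (b1 * c2 - c1 * b2) * (a3 * x + b3 * y + c3 * z)"
    by (simp add: algebra_simps)
  then show ?thesis
    by (simp add: assms)
qed

lemma char_2_cubic_root_powers:
  fixes t :: "'a::comm_ring_1"
  assumes two: "(2::'a) = 0" and t: "t ^ 3 = t ^ 2 + 1"
  shows "t ^ 4 = t ^ 2 + t + 1" "t ^ 5 = t + 1" "t ^ 6 = t ^ 2 + t" "t ^ 7 = 1"
proof -
  note char_2 = char_2_add_self[OF two]
  have t': "t * (t * t) = t * t + 1"
    using t by (simp add: power3_eq_cube power2_eq_square mult.assoc)
  show 4: "t ^ 4 = t ^ 2 + t + 1"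
    using t' by (simp add: eval_nat_numeral algebra_simps)
  show 5: "t ^ 5 = t + 1"
    using t' 4 by (simp add: eval_nat_numeral algebra_simps char_2)
  show 6: "t ^ 6 = t ^ 2 + t"
    using t' 5 by (simp add: eval_nat_numeral algebra_simps char_2)
  show "t ^ 7 = 1"
    using t' 6 by (simp add: eval_nat_numeral algebra_simps char_2)
qed

text \<open>The factors are \<open>a + s * b + s ^ 3 * c\<close> at the conjugate roots
  \<open>s = t, t ^ 2, t ^ 4\<close> of the cubic.\<close>

lemma cubic_factorization:
  fixes a b c t :: "'a::comm_ring_1"
  assumes two: "(2::'a) = 0" and t: "t ^ 3 = t ^ 2 + 1"
  shows "a ^ 3 + b ^ 3 + c ^ 3 + a ^ 2 * b + b ^ 2 * c + c ^ 2 * a + a * b * c =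
    (a + t * b + t ^ 3 * c) * (a + t ^ 2 * b + (t ^ 2) ^ 3 * c) * (a + t ^ 4 * b + (t ^ 4) ^ 3 * c)"
proof -
  note pow = char_2_cubic_root_powers[OF two t]
  have t': "t * (t * t) = t * t + 1"
    using t by (simp add: power3_eq_cube power2_eq_square mult.assoc)
  \<comment> \<open>The same reduction for right-nested products, the form in which
    \<open>algebra_simps\<close> leaves monomials.\<close>
  have t'': "t * (t * (t * z)) = t * (t * z) + z" for z
    using arg_cong[OF t', of "\<lambda>y. y * z"] by (simp add: algebra_simps)
  have 12: "(t ^ 4) ^ 3 = t + 1"
    using pow(2) pow(4) power_add[of t 7 5] by (simp flip: power_mult)
  have 6: "(t ^ 2) ^ 3 = t ^ 2 + t"
    using pow(3) by (simp flip: power_mult)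
  show ?thesis
    unfolding 12 6 t pow(1)
    by (simp add: power3_eq_cube power2_eq_square algebra_simps t' t'' char_2_add_self[OF two])
qed

section \<open>Nonvanishing of the conjugate linear forms\<close>

text \<open>Since 2 has order 3 modulo 7, only the residue 2 has to be excluded.\<close>

lemma two_power_mod_7:
  fixes m :: nat
  assumes "\<not> [m = 1] (mod 3)"
  shows "(2::nat) ^ m mod 7 = 1 \<or> (2::nat) ^ m mod 7 = 4"
proof -
  define k where "k = m div 3"
  have *: "[(8::nat) ^ k = 1 ^ k] (mod 7)"
    by (rule cong_pow) (simp add: cong_def)
  have "m mod 3 = 0 \<or> m mod 3 = 2"
    using assms by (auto simp: cong_def)
  then have "m = 3 * k \<or> m = 3 * k + 2"
    using mult_div_mod_eq[of 3 m] unfolding k_def by linarith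
  then show ?thesis
    using * cong_scalar_right[OF *, of 4]
    by (auto simp: cong_def power_add power_mult mult.commute[of 4])
qed

text \<open>The form and its two conjugates are a linear system in \<open>a\<close>,
  \<open>b\<close>, \<open>c\<close> whose determinant is \<open>t ^ 4\<close> or \<open>1\<close>.
  For \<open>q\<close> congruent to 2 modulo 7 it would vanish.\<close>

lemma frobenius_linear_form_eq_0_imp:
  fixes a t :: "'a::{field, finite}"
  assumes card: "CARD('a) = 2 ^ (3 * m)" and m: "\<not> [m = 1] (mod 3)"
    and t: "t ^ 3 = t ^ 2 + 1"
    and form: "a + t * a ^ (2 ^ m) + t ^ 3 * a ^ (2 ^ (2 * m)) = 0"
  shows "a = 0"
proof -
  have char: "CHAR('a) = 2"
    by (rule CHAR_eq_2_of_card[OF card])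
  then have two: "(2::'a) = 0"
    using of_nat_CHAR[where 'a = 'a] by simp
  define q :: nat where "q = 2 ^ m"
  have add_q: "(x + y) ^ q = x ^ q + y ^ q" for x y :: 'a
    by (rule freshmans_dream') (simp_all add: char q_def)
  define b c where "b = a ^ q" and "c = b ^ q"
  have q2: "2 ^ (2 * m) = q * q"
    by (simp add: q_def mult_2 power_add)
  have q3: "2 ^ (3 * m) = q * q * q"
    by (simp add: q_def power3_eq_cube power_mult mult.commute[of 3])
  have "c ^ q = a"
    using power_card_eq_self[of a] unfolding card q3 by (simp add: b_def c_def power_mult)
  have t7: "t ^ 7 = 1"
    by (rule char_2_cubic_root_powers(4)[OF two t])
  \<comment> \<open>The coefficients \<open>1\<close> are kept so that the equations match
    \<open>cramer3\<close>.\<close>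
  have e1: "1 * a + t * b + t ^ 3 * c = 0"
    using form by (simp add: b_def c_def q2 flip: q_def power_mult)
  have e2: "(t ^ q) ^ 3 * a + 1 * b + t ^ q * c = 0"
  proof -
    have "(1 * a + t * b + t ^ 3 * c) ^ q = 0"
      by (simp only: e1) (simp add: q_def)
    then show ?thesis
      by (simp add: add_q power_mult_distrib \<open>c ^ q = a\<close> power_commutes power_mult[symmetric]
          mult.commute[of 3] ac_simps flip: b_def c_def)
  qed
  have e3: "t ^ (q * q) * a + (t ^ (q * q)) ^ 3 * b + 1 * c = 0"
  proof -
    have "((t ^ q) ^ 3 * a + 1 * b + t ^ q * c) ^ q = 0"
      by (simp only: e2) (simp add: q_def)
    then show ?thesis
      by (simp add: add_q power_mult_distrib \<open>c ^ q = a\<close> power_mult[symmetric]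
          ac_simps flip: b_def c_def)
  qed
  from two_power_mod_7[OF m] show "a = 0"
  proof
    assume "2 ^ m mod 7 = (1::nat)"
    then have *: "t ^ q = t"
      using power_mod_exponent[OF t7, of q] by (simp add: q_def)
    have "(1 * (1 * 1 - t * t ^ 3) + t * (t * t - t ^ 3 * 1) + t ^ 3 * (t ^ 3 * t ^ 3 - 1 * t)) * a = 0"
      using cramer3[OF e1 e2 e3] by (simp add: * power_mult)
    \<comment> \<open>This circulant determinant is \<open>1 + t ^ 2 + t ^ 3 + t ^ 4\<close>, and
      the first three terms cancel by the cubic.\<close>
    moreover have "1 * (1 * 1 - t * t ^ 3) + t * (t * t - t ^ 3 * 1) + t ^ 3 * (t ^ 3 * t ^ 3 - 1 * t) = t ^ 4"
    proof -
      have cube: "t * (t * t) = t ^ 3"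
        by (simp add: power3_eq_cube)
      have "1 * (1 * 1 - t * t ^ 3) + t * (t * t - t ^ 3 * 1) + t ^ 3 * (t ^ 3 * t ^ 3 - 1 * t) =
          1 + t ^ 4 + (t ^ 3 + t ^ 4) + (t ^ 9 + t ^ 4)"
        unfolding char_2_diff[OF two]
        by (simp add: distrib_left cube flip: power_Suc power_Suc2 power_add)
      also have "t ^ 9 = t ^ 2"
        using power_mod_exponent[OF t7, of 9] by simp
      also have "1 + t ^ 4 + (t ^ 3 + t ^ 4) + (t ^ 2 + t ^ 4) = t ^ 4"
        unfolding t by (simp add: add_ac char_2_add_self[OF two])
      finally show ?thesis .
    qed
    moreover have "t \<noteq> 0"
      using t7 by auto
    ultimately show ?thesis
      by simp
  next
    assume "2 ^ m mod 7 = (4::nat)"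
    then have *: "t ^ q = t ^ 4"
      using power_mod_exponent[OF t7, of q] by (simp add: q_def)
    have "t ^ (q * q) = (t ^ q) ^ q"
      by (rule power_mult)
    also have "\<dots> = (t ^ q) ^ 4"
      unfolding * by (metis * power_mult mult.commute)
    also have "\<dots> = t ^ 16"
      unfolding * by (simp flip: power_mult)
    also have "\<dots> = t ^ 2"
      using power_mod_exponent[OF t7, of 16] by simp
    finally have **: "t ^ (q * q) = t ^ 2" .
    have "(1 * (1 * 1 - t ^ 4 * (t ^ 2) ^ 3) + t * (t ^ 4 * t ^ 2 - (t ^ 4) ^ 3 * 1) +
        t ^ 3 * ((t ^ 4) ^ 3 * (t ^ 2) ^ 3 - 1 * t ^ 2)) * a = 0"
      using cramer3[OF e1 e2 e3] unfolding * ** .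
    moreover have "1 * (1 * 1 - t ^ 4 * (t ^ 2) ^ 3) + t * (t ^ 4 * t ^ 2 - (t ^ 4) ^ 3 * 1) +
        t ^ 3 * ((t ^ 4) ^ 3 * (t ^ 2) ^ 3 - 1 * t ^ 2) = 1"
    proof -
      have "1 * (1 * 1 - t ^ 4 * (t ^ 2) ^ 3) + t * (t ^ 4 * t ^ 2 - (t ^ 4) ^ 3 * 1) +
          t ^ 3 * ((t ^ 4) ^ 3 * (t ^ 2) ^ 3 - 1 * t ^ 2) =
          1 + t ^ 10 + (t ^ 7 + t ^ 13) + (t ^ 21 + t ^ 5)"
        unfolding char_2_diff[OF two]
        by (simp add: distrib_left flip: power_Suc power_add)
      also have "t ^ 10 = t ^ 3"
        using power_mod_exponent[OF t7, of 10] by simp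
      also have "t ^ 13 = t ^ 6"
        using power_mod_exponent[OF t7, of 13] by simp
      also have "t ^ 21 = 1"
        using power_mod_exponent[OF t7, of 21] by simp
      also have "1 + t ^ 3 + (t ^ 7 + t ^ 6) + (1 + t ^ 5) = 1"
        unfolding t char_2_cubic_root_powers[OF two t]
        by (simp add: add_ac char_2_add_self[OF two])
      finally show ?thesis .
    qed
    ultimately show ?thesis
      by (simp only: mult_1)
  qed
qed

theorem proposition3p8:
  fixes m :: nat and f :: "'a::{field, finite} \<Rightarrow> 'a"
  assumes "m > 0"
    and "\<not> [m = 1] (mod 3)"
    and "CARD('a) = 2 ^ (3 * m)"
    and "\<And>x. f x = x ^ (2 ^ (2 * m) + 1) + x ^ (2 ^ (2 * m) + 2 ^ m)"
  shows "pseudo_planar f"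
  unfolding pseudo_planar_def
proof (intro allI impI)
  fix a :: 'a
  assume "a \<noteq> 0"
  note card = assms(3)
  have char: "CHAR('a) = 2"
    by (rule CHAR_eq_2_of_card[OF card])
  then have two: "(2::'a) = 0"
    using of_nat_CHAR[where 'a = 'a] by simp
  define q :: nat where "q = 2 ^ m"
  define r :: nat where "r = 2 ^ (2 * m)"
  have r: "r = q * q"
    by (simp add: q_def r_def mult_2 power_add)
  have q3: "2 ^ (3 * m) = q * q * q"
    by (simp add: q_def power3_eq_cube power_mult mult.commute[of 3])
  have add_q: "(x + y) ^ q = x ^ q + y ^ q" for x y :: 'a
    by (rule freshmans_dream') (simp_all add: char q_def)
  have add_r: "(x + y) ^ r = x ^ r + y ^ r" for x y :: 'a
    by (rule freshmans_dream') (simp_all add: char r_def)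
  \<comment> \<open>The field has \<open>q * q * q\<close> elements, so the \<open>q\<close>-power
    map cycles \<open>x\<close>, \<open>x ^ q\<close>, \<open>x ^ r\<close>.\<close>
  have q_q: "(x ^ q) ^ q = x ^ r" and r_q: "(x ^ r) ^ q = x" for x :: 'a
    using power_card_eq_self[of x] unfolding card q3 by (simp_all add: r flip: power_mult)
  have f: "f x = x ^ r * x + x ^ r * x ^ q" for x
    by (simp add: assms(4) r_def q_def power_add mult.commute)
  define b c where "b = a ^ q" and "c = a ^ r"
  note char_2 = char_2_add_self[OF two]
  have affine: "f (x + a) + f x + a * x = (a + c) * x + c * x ^ q + (a + b) * x ^ r + f a" for x
    unfolding f add_q add_r by (simp add: algebra_simps char_2 flip: b_def c_def)
  have "inj (\<lambda>x. f (x + a) + f x + a * x)"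
  proof (rule injI)
    fix x y
    assume eq: "f (x + a) + f x + a * x = f (y + a) + f y + a * y"
    \<comment> \<open>In characteristic two this is the difference \<open>x - y\<close>, an element
      of the kernel of the additive part.\<close>
    define u where "u = x + y"
    have e1: "(a + c) * u + c * u ^ q + (a + b) * u ^ r = 0"
    proof -
      have "(a + c) * u + c * u ^ q + (a + b) * u ^ r =
          ((a + c) * x + c * x ^ q + (a + b) * x ^ r) + ((a + c) * y + c * y ^ q + (a + b) * y ^ r)"
        unfolding u_def add_q add_r by (simp add: algebra_simps)
      also have "(a + c) * x + c * x ^ q + (a + b) * x ^ r = (a + c) * y + c * y ^ q + (a + b) * y ^ r"
        using eq unfolding affine by simp
      finally show ?thesis
        by (simp add: char_2(1))
    qed
    have q0: "(0::'a) ^ q = 0"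
      by (simp add: q_def)
    have conj: "a ^ q = b" "b ^ q = c" "c ^ q = a"
      by (simp_all add: b_def c_def q_q r_q)
    have e2: "(b + c) * u + (b + a) * u ^ q + a * u ^ r = 0"
      using arg_cong[OF e1, of "\<lambda>z. z ^ q"]
      by (simp add: add_q power_mult_distrib conj q_q r_q q0 add_ac)
    have e3: "b * u + (c + a) * u ^ q + (c + b) * u ^ r = 0"
      using arg_cong[OF e2, of "\<lambda>z. z ^ q"]
      by (simp add: add_q power_mult_distrib conj q_q r_q q0 add_ac)
    have "(a ^ 3 + b ^ 3 + c ^ 3 + a ^ 2 * b + b ^ 2 * c + c ^ 2 * a + a * b * c) * u = 0"
      using cramer3[OF e1 e2 e3] unfolding char_2_diff[OF two]
      by (simp add: power3_eq_cube power2_eq_square algebra_simps char_2)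
    moreover
    obtain t :: 'a where t: "t ^ 3 = t ^ 2 + 1"
      using exists_cubic_root_char_2[OF card assms(1)] by blast
    \<comment> \<open>Squaring is a ring homomorphism here, so it maps roots of the cubic to roots;
      this makes the linear-form lemma available for all three factors.\<close>
    have sq: "(s ^ 2) ^ 3 = (s ^ 2) ^ 2 + 1" if "s ^ 3 = s ^ 2 + 1" for s :: 'a
    proof -
      have "(s ^ 2) ^ 3 = (s ^ 3) ^ 2"
        by (simp flip: power_mult)
      also have "\<dots> = (s ^ 2) ^ 2 + 1"
        unfolding that by (simp add: power2_eq_square algebra_simps char_2)
      finally show ?thesis .
    qed
    have "(t ^ 4) ^ 3 = (t ^ 4) ^ 2 + 1"
      using sq[OF sq[OF t]] by (simp flip: power_mult)
    then have "a + s * b + s ^ 3 * c \<noteq> 0" if "s \<in> {t, t ^ 2, t ^ 4}" for s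
      using frobenius_linear_form_eq_0_imp[OF card assms(2), of s a] t sq[OF t] that \<open>a \<noteq> 0\<close>
      by (auto simp: b_def c_def q_def r_def)
    then have "a ^ 3 + b ^ 3 + c ^ 3 + a ^ 2 * b + b ^ 2 * c + c ^ 2 * a + a * b * c \<noteq> 0"
      \<comment> \<open>Powers such as \<open>(t ^ 2) ^ 3\<close> must stay unmerged to match
        \<open>s ^ 3\<close> in the previous fact.\<close>
      unfolding cubic_factorization[OF two t] by (simp del: power_mult_numeral)
    ultimately have "u = 0"
      by simp
    then show "x = y"
      using char_2_diff[OF two, of x y] by (simp add: u_def)
  qed
  then show "bij (\<lambda>x. f (x + a) + f x + a * x)"
    by (simp add: bij_def finite_UNIV_inj_surj)
qed

end
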